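(* For all real $x>0$, $$MY(x)=\frac{1}{3\,F\left(\frac13,\frac23,\frac12,1-\frac{27x}{2}\right)}.$$
   Context: The function $MY:[0,+\infty)\to[0,+\infty)$ is the inverse of the strictly increasing continuous bijection $[0,+\infty)\to[0,+\infty)$, $z\mapsto \frac{z^3+z^2}{2}$; that is, for $x\ge 0$, $MY(x)$ is the unique real $z\ge 0$ with $\frac{z^3+z^2}{2}=x$. $F(a,b,c,z)={}_2F_1(a,b;c;z)$ is the Gaussian hypergeometric function, analytically continued from the unit disc to $\mathbb{C}\setminus[1,+\infty)$. *)

theory Defs
  imports "HOL-Complex_Analysis.Complex_Analysis"
begin

definition MY :: "real \<Rightarrow> real" where
  "MY = the_inv_into {0..} (\<lambda>z. (z ^ 3 + z ^ 2) / 2)"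

(* The Gauss series with coefficients (a)_n (b)_n / ((c)_n n!); the last argument 1 of fps_hypergeo
   is a scaling of the variable. Meaningful for norm z < 1 and c not a nonpositive integer. *)
definition hyp2F1_series :: "complex \<Rightarrow> complex \<Rightarrow> complex \<Rightarrow> complex \<Rightarrow> complex" where
  "hyp2F1_series a b c z = eval_fps (fps_hypergeo [a, b] [c] 1) z"

(* The analytic continuation is unique only as a function on the complement of [1, oo), so the
   description operator is applied to its value at z rather than to a total function on the complex
   numbers. For z in [1, oo) the value is unspecified. *)
definition hyp2F1 :: "complex \<Rightarrow> complex \<Rightarrow> complex \<Rightarrow> complex \<Rightarrow> complex" where
  "hyp2F1 a b c z =
     (THE w. \<exists>f. f holomorphic_on (- complex_of_real ` {1..}) \<and>
                 (\<forall>u\<in>ball 0 1. f u = hyp2F1_series a b c u) \<and> f z = w)"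

end

theory Submission
  imports Defs
begin

text \<open>
  Put \<open>q = 3 MY(x)\<close> and \<open>u = 1 - 27 x / 2\<close>; then \<open>q\<^sup>2 (q + 3) = 4 (1 - u)\<close>, and \<open>q = 1\<close> at \<open>u = 0\<close>.
  Differentiating this cubic equation shows that any holomorphic solution \<open>q(u)\<close> without the values
  \<open>0\<close> and \<open>-2\<close> makes \<open>1/q\<close> a solution of the hypergeometric equation with parameters
  \<open>1/3, 2/3; 1/2\<close>, so \<open>1/q\<close> is the continued Gauss function.
  To obtain \<open>q\<close> on the whole slit plane, substitute \<open>q = 4 C\<^sup>2 - 3\<close>: the cubic becomes
  \<open>(4 C\<^sup>3 - 3 C)\<^sup>2 = 1 - u\<close>, i.e. \<open>4 C\<^sup>3 - 3 C = \<surd>(1 - u)\<close> in the right half plane, and the Chebyshev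
  polynomial \<open>4 C\<^sup>3 - 3 C\<close> maps the inside of one branch of a hyperbola biholomorphically onto
  that half plane.
\<close>

section \<open>The cubic Chebyshev polynomial as a bijection onto the right half plane\<close>

definition half_plane :: "complex set" where
  "half_plane = {s. Re s > 0}"

definition cheb3 :: "complex \<Rightarrow> complex" where
  "cheb3 w = 4 * w ^ 3 - 3 * w"

text \<open>The inside of the right branch of the hyperbola \<open>x^2 - 3 y^2 = 3/4\<close>,
  written as a preimage so that openness and the inclusion of the image in \<open>half_plane\<close>
  are immediate.\<close>

definition cheb3_dom :: "complex set" where
  "cheb3_dom = {w. Re w > 0 \<and> Re (cheb3 w) > 0}"

lemma Re_cheb3: "Re (cheb3 w) = Re w * (4 * (Re w)\<^sup>2 - 12 * (Im w)\<^sup>2 - 3)"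
  by (simp add: cheb3_def power3_eq_cube power2_eq_square algebra_simps)

lemma cheb3_dom_iff: "w \<in> cheb3_dom \<longleftrightarrow> Re w > 0 \<and> (Re w)\<^sup>2 > 3 * (Im w)\<^sup>2 + 3 / 4"
  by (auto simp: cheb3_dom_def Re_cheb3 zero_less_mult_iff)

lemma cheb3_dom_abs_Im_less:
  assumes "w \<in> cheb3_dom"
  shows "\<bar>Im w\<bar> < Re w"
proof -
  have "(Im w)\<^sup>2 < (Re w)\<^sup>2"
    using assms zero_le_power2[of "Im w"] unfolding cheb3_dom_iff by linarith
  thus ?thesis
    using assms by (auto simp: cheb3_dom_iff intro!: power2_less_imp_less[of "\<bar>Im w\<bar>" "Re w"])
qed

text \<open>After division by \<open>v - w\<close> there remains
  \<open>4 * (v^2 + v * w + w^2) - 3\<close>, whose real part is positive: the real parts of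
  \<open>v^2\<close> and \<open>w^2\<close> exceed 3/4, and that of \<open>v * w\<close> is
  nonnegative because both points have argument of modulus below pi/4.\<close>

lemma inj_on_cheb3: "inj_on cheb3 cheb3_dom"
proof (rule inj_onI, rule ccontr)
  fix v w assume v: "v \<in> cheb3_dom" and w: "w \<in> cheb3_dom"
    and eq: "cheb3 v = cheb3 w" and neq: "v \<noteq> w"
  have "(v - w) * (4 * (v\<^sup>2 + v * w + w\<^sup>2) - 3) = cheb3 v - cheb3 w"
    by (simp add: cheb3_def power3_eq_cube power2_eq_square algebra_simps)
  hence "4 * (v\<^sup>2 + v * w + w\<^sup>2) - 3 = 0"
    using eq neq by simp
  hence "Re (4 * (v\<^sup>2 + v * w + w\<^sup>2) - 3) = 0" by simp
  hence *: "4 * ((Re v)\<^sup>2 - (Im v)\<^sup>2 + (Re v * Re w - Im v * Im w) + ((Re w)\<^sup>2 - (Im w)\<^sup>2)) = 3"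
    by (simp add: power2_eq_square algebra_simps)
  have "\<bar>Im v\<bar> * \<bar>Im w\<bar> \<le> Re v * Re w"
    using cheb3_dom_abs_Im_less[OF v] cheb3_dom_abs_Im_less[OF w] by (intro mult_mono) auto
  hence "Re v * Re w - Im v * Im w \<ge> 0"
    using abs_ge_self[of "Im v * Im w"] by (simp add: abs_mult)
  moreover have "(Re v)\<^sup>2 > 3 * (Im v)\<^sup>2 + 3 / 4" "(Re w)\<^sup>2 > 3 * (Im w)\<^sup>2 + 3 / 4"
    using v w by (auto simp: cheb3_dom_iff)
  ultimately show False
    using * zero_le_power2[of "Im v"] zero_le_power2[of "Im w"] by argo
qed

text \<open>Surjectivity is the triple angle formula: if \<open>s = cos t\<close>, then
  \<open>cos (t / 3)\<close> is a preimage. The sign of its real part is that of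
  \<open>cos (Re t / 3)\<close>, which is positive since \<open>Arccos\<close> gives
  \<open>\<bar>Re t\<bar>\<close> at most pi.\<close>

lemma cheb3_image: "cheb3 ` cheb3_dom = half_plane"
proof (intro equalityI subsetI)
  fix s assume "s \<in> half_plane"
  hence s: "Re s > 0" by (simp add: half_plane_def)
  define t where "t = Arccos s"
  have ct: "cos t = s" by (simp add: t_def)
  have "0 < exp (Im t) + exp (- Im t)" by (intro add_pos_pos) auto
  hence "cos (Re t) > 0"
    using s unfolding ct[symmetric] Re_cos by (simp add: zero_less_mult_iff)
  moreover have "\<bar>Re t\<bar> \<le> pi" using Re_Arccos_bound by (simp add: t_def)
  ultimately have "\<bar>Re t\<bar> < pi"
    by (cases "\<bar>Re t\<bar> = pi") (auto simp: cos_abs_real[of "Re t", symmetric] simp del: cos_abs_real)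
  hence "cos (Re (t / 3)) > 0" by (intro cos_gt_zero_pi) auto
  moreover have "0 < exp (Im (t / 3)) + exp (- Im (t / 3))" by (intro add_pos_pos) auto
  ultimately have "Re (cos (t / 3)) > 0" unfolding Re_cos by simp
  moreover have "cheb3 (cos (t / 3)) = s"
    using cos_treble_cos[of "t / 3"] ct by (simp add: cheb3_def)
  ultimately show "s \<in> cheb3 ` cheb3_dom"
    using s by (auto simp: cheb3_dom_def intro!: image_eqI[of _ _ "cos (t / 3)"])
qed (auto simp: cheb3_dom_def half_plane_def)

lemma open_cheb3_dom: "open cheb3_dom"
  unfolding cheb3_dom_def cheb3_def
  by (intro open_Collect_conj open_Collect_less continuous_intros)

section \<open>The slit plane and the continued Gauss series\<close>

definition slit_plane :: "complex set" where
  "slit_plane = - complex_of_real ` {1..}"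

lemma slit_plane_iff: "u \<in> slit_plane \<longleftrightarrow> 1 - u \<notin> \<real>\<^sub>\<le>\<^sub>0"
proof -
  have "u \<in> complex_of_real ` {1..} \<longleftrightarrow> 1 - u \<in> \<real>\<^sub>\<le>\<^sub>0"
    by (auto simp: complex_nonpos_Reals_iff complex_eq_iff intro!: image_eqI[of _ _ "Re u"])
  thus ?thesis by (simp add: slit_plane_def)
qed

lemma open_slit_plane: "open slit_plane"
  unfolding slit_plane_def by (intro open_Compl closed_slot_right)

lemma ball_subset_slit_plane: "ball 0 1 \<subseteq> slit_plane"
  by (auto simp: slit_plane_def)

lemma connected_slit_plane: "connected slit_plane"
  unfolding slit_plane_def
  by (intro starlike_imp_connected starlike_slotted_complex_plane_right)

text \<open>The identity theorem on the connected slit plane shows that any two continuations from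
  the unit disc agree, so the description in \<open>hyp2F1\<close> has a unique value.\<close>

lemma hyp2F1_eq_continuation:
  assumes "f holomorphic_on slit_plane"
    and "\<And>u. u \<in> ball 0 1 \<Longrightarrow> f u = hyp2F1_series a b c u"
    and "z \<in> slit_plane"
  shows "hyp2F1 a b c z = f z"
  unfolding hyp2F1_def slit_plane_def[symmetric]
proof (rule the_equality)
  fix w assume "\<exists>h. h holomorphic_on slit_plane \<and>
    (\<forall>u\<in>ball 0 1. h u = hyp2F1_series a b c u) \<and> h z = w"
  then obtain h where h: "h holomorphic_on slit_plane"
    "\<And>u. u \<in> ball 0 1 \<Longrightarrow> h u = hyp2F1_series a b c u" "h z = w"
    by blast
  have "h z = f z"
    by (rule analytic_continuation_open[of "ball 0 1" slit_plane])
       (use assms h open_slit_plane connected_slit_plane ball_subset_slit_plane in auto)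
  thus "w = f z" using h by simp
qed (use assms in blast)

text \<open>The coefficient of \<open>X^n\<close> in the equation is a two-term recurrence for the
  coefficients of \<open>F\<close>; the condition on \<open>c\<close> keeps its leading factor
  nonzero.\<close>

lemma fps_hypergeo_eqI:
  fixes F :: "complex fps"
  assumes F0: "fps_nth F 0 = 1" and c: "\<And>n. c \<noteq> - of_nat n"
    and ode: "fps_X * (1 - fps_X) * fps_deriv (fps_deriv F) +
       (fps_const c - fps_const (a + b + 1) * fps_X) * fps_deriv F - fps_const (a * b) * F = 0"
  shows "F = fps_hypergeo [a, b] [c] 1"
proof (rule fps_ext)
  fix n
  show "fps_nth F n = fps_nth (fps_hypergeo [a, b] [c] 1) n"
  proof (induction n)
    case 0
    show ?case using F0 by simp
  next
    case (Suc n)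
    let ?D = "fps_deriv F" and ?DD = "fps_deriv (fps_deriv F)"
    have "fps_nth (fps_X * ?DD - fps_X * (fps_X * ?DD) + fps_const c * ?D
       - fps_const (a + b + 1) * (fps_X * ?D) - fps_const (a * b) * F) n = 0"
      using arg_cong[OF ode, of "\<lambda>F. fps_nth F n"] by (simp add: algebra_simps)
    \<comment> \<open>Multiplication by \<open>fps_X\<close> shifts indices, once or twice, so n = 0
      and n = 1 are separate cases.\<close>
    hence "of_nat (Suc n) * (c + of_nat n) * fps_nth F (Suc n) =
        (a + of_nat n) * (b + of_nat n) * fps_nth F n"
      by (cases n; cases "n - 1") (auto simp: algebra_simps)
    moreover have "of_nat (Suc n) * (c + of_nat n) \<noteq> 0"
      using c[of n] by (auto simp: add_eq_0_iff2 simp del: of_nat_Suc)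
    ultimately have "fps_nth F (Suc n) =
        (a + of_nat n) * (b + of_nat n) / (of_nat (Suc n) * (c + of_nat n)) * fps_nth F n"
      by (simp add: field_simps del: of_nat_Suc)
    thus ?case unfolding Suc.IH fps_hypergeo_rec by (simp add: mult_ac)
  qed
qed

text \<open>The Taylor series of \<open>f\<close> at 0 satisfies the formal equation, hence is the
  Gauss series. A single initial value suffices because 0 is a singular point of the
  equation.\<close>

lemma hyp2F1_eqI_ode:
  assumes holf: "f holomorphic_on slit_plane" and f0: "f 0 = 1"
    and c: "\<And>n. c \<noteq> - of_nat n"
    and ode: "\<And>u. u \<in> slit_plane \<Longrightarrow>
      u * (1 - u) * deriv (deriv f) u + (c - (a + b + 1) * u) * deriv f u - a * b * f u = 0"
    and z: "z \<in> slit_plane"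
  shows "hyp2F1 a b c z = f z"
proof (rule hyp2F1_eq_continuation[OF holf _ z])
  define F where "F = fps_expansion f 0"
  have 0: "0 \<in> slit_plane"
    using ball_subset_slit_plane by auto
  have F: "f has_fps_expansion F"
    unfolding F_def by (rule has_fps_expansion_fps_expansion[OF open_slit_plane 0 holf])
  define E where "E = fps_X * (1 - fps_X) * fps_deriv (fps_deriv F) +
       (fps_const c - fps_const (a + b + 1) * fps_X) * fps_deriv F - fps_const (a * b) * F"
  have "(\<lambda>u. u * (1 - u) * deriv (deriv f) u + (c - (a + b + 1) * u) * deriv f u - a * b * f u)
      has_fps_expansion E"
    unfolding E_def by (intro fps_expansion_intros F)
  moreover have "eventually (\<lambda>u. u * (1 - u) * deriv (deriv f) u +
      (c - (a + b + 1) * u) * deriv f u - a * b * f u = 0) (nhds 0)"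
    using eventually_nhds_in_open[OF open_slit_plane 0] by eventually_elim (rule ode)
  ultimately have "(\<lambda>u. 0) has_fps_expansion E"
    by (subst (asm) has_fps_expansion_cong[OF _ refl])
  hence "E = 0"
    by (rule fps_expansion_unique_complex[OF _ has_fps_expansion_0])
  moreover have "fps_nth F 0 = 1"
    using has_fps_expansion_imp_0_eq_fps_nth_0[OF F] f0 by simp
  ultimately have F_eq: "F = fps_hypergeo [a, b] [c] 1"
    using c unfolding E_def by (intro fps_hypergeo_eqI)
  fix u :: complex assume u: "u \<in> ball 0 1"
  \<comment> \<open>Holomorphy on the unit disc makes the Taylor series represent \<open>f\<close>
    on all of it, not only near 0.\<close>
  have "eval_fps F u = f u"
    by (rule has_fps_expansion_imp_eval_fps_eq[OF F, of _ 1])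
       (use u holomorphic_on_subset[OF holf ball_subset_slit_plane] in auto)
  thus "f u = hyp2F1_series a b c u"
    unfolding hyp2F1_series_def F_eq by simp
qed

section \<open>From the cubic equation to the hypergeometric equation\<close>

lemma deriv_cubic_root:
  assumes holq: "q holomorphic_on S" and S: "open S"
    and eq: "\<And>u. u \<in> S \<Longrightarrow> (q u)\<^sup>2 * (q u + 3) = 4 * (1 - u)"
    and nz: "q u \<noteq> 0" "q u \<noteq> -2" and u: "u \<in> S"
  shows "(q has_field_derivative - 4 / (3 * q u * (q u + 2))) (at u)"
proof -
  have q: "(q has_field_derivative deriv q u) (at u)"
    using holomorphic_derivI[OF holq S u] .
  \<comment> \<open>The critical points of \<open>q^2 (q + 3)\<close> are 0 and -2; away from them
    the differentiated equation can be solved for the derivative of \<open>q\<close>.\<close>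
  have "((\<lambda>u. (q u)\<^sup>2 * (q u + 3)) has_field_derivative
      3 * q u * (q u + 2) * deriv q u) (at u)"
    by (rule derivative_eq_intros q refl)+ (simp add: algebra_simps power2_eq_square)
  moreover have "((\<lambda>u. (q u)\<^sup>2 * (q u + 3)) has_field_derivative - 4) (at u)"
  proof (rule has_field_derivative_transform_within_open[OF _ S u])
    show "((\<lambda>u. 4 * (1 - u)) has_field_derivative - 4) (at u)"
      by (auto intro!: derivative_eq_intros)
  qed (simp add: eq)
  ultimately have "3 * q u * (q u + 2) * deriv q u = - 4"
    by (rule DERIV_unique)
  moreover have "q u + 2 \<noteq> 0" using nz by (simp add: eq_neg_iff_add_eq_0)
  ultimately have "deriv q u = - 4 / (3 * q u * (q u + 2))"
    using nz(1) by (simp only: eq_divide_eq mult_eq_0_iff) (simp add: mult_ac)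
  with q show ?thesis by simp
qed

text \<open>The cubic makes \<open>u\<close> a polynomial in \<open>Q = q u\<close>, and
  \<open>f\<close> and its derivatives are rational in \<open>Q\<close>, so the equation becomes a
  polynomial identity in \<open>Q\<close>.\<close>

lemma hypergeometric_ode_inverse_cubic_root:
  fixes q :: "complex \<Rightarrow> complex"
  assumes holq: "q holomorphic_on S" and S: "open S"
    and eq: "\<And>u. u \<in> S \<Longrightarrow> (q u)\<^sup>2 * (q u + 3) = 4 * (1 - u)"
    and nz: "\<And>u. u \<in> S \<Longrightarrow> q u \<noteq> 0" "\<And>u. u \<in> S \<Longrightarrow> q u \<noteq> -2" and u: "u \<in> S"
  defines "f \<equiv> \<lambda>u. 1 / q u"
  shows "u * (1 - u) * deriv (deriv f) u + (1/2 - 2 * u) * deriv f u - 2/9 * f u = 0"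
proof -
  have q': "(q has_field_derivative - 4 / (3 * q v * (q v + 2))) (at v)" if "v \<in> S" for v
    by (rule deriv_cubic_root[OF holq S eq nz(1)[OF that] nz(2)[OF that] that])
  have nz2: "q u + 2 \<noteq> 0" if "u \<in> S" for u
    using nz(2)[OF that] by (simp add: eq_neg_iff_add_eq_0)
  have f': "deriv f v = 4 / (3 * (q v) ^ 3 * (q v + 2))" if v: "v \<in> S" for v
  proof (rule DERIV_imp_deriv)
    have "(f has_field_derivative - (- 4 / (3 * q v * (q v + 2))) / (q v * q v)) (at v)"
      unfolding f_def using DERIV_divide[OF DERIV_const q'[OF v] nz(1)[OF v], of 1] by simp
    thus "(f has_field_derivative 4 / (3 * (q v) ^ 3 * (q v + 2))) (at v)"
      by (simp add: power3_eq_cube mult_ac)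
  qed
  define Q where "Q = q u"
  define P where "P = Q + 2"
  have Q: "Q \<noteq> 0" and P: "P \<noteq> 0" using nz(1)[OF u] nz2[OF u] by (auto simp: Q_def P_def)
  define D where "D = - 4 / (3 * Q * P)"
  have D: "(q has_field_derivative D) (at u)"
    using q'[OF u] by (simp add: D_def P_def Q_def)
  have "((\<lambda>v. 4 / (3 * (q v) ^ 3 * (q v + 2))) has_field_derivative
      - (4 * (9 * Q\<^sup>2 * D * P + 3 * Q ^ 3 * D)) / (3 * Q ^ 3 * P)\<^sup>2) (at u)"
    unfolding P_def Q_def
    by (rule derivative_eq_intros D refl)+
       (use nz(1)[OF u] nz2[OF u] in \<open>auto simp: power2_eq_square mult_ac\<close>)
  moreover have "- (4 * (9 * Q\<^sup>2 * D * P + 3 * Q ^ 3 * D)) / (3 * Q ^ 3 * P)\<^sup>2 =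
      16 * (3 * P + Q) / (9 * Q ^ 5 * P ^ 3)"
    unfolding D_def using Q P
    by (simp add: divide_simps power_numeral_reduce) (simp add: algebra_simps)
  moreover have "16 * (3 * P + Q) = 32 * (2 * Q + 3)"
    by (simp add: P_def algebra_simps)
  ultimately have "((\<lambda>v. 4 / (3 * (q v) ^ 3 * (q v + 2))) has_field_derivative
      32 * (2 * Q + 3) / (9 * Q ^ 5 * P ^ 3)) (at u)"
    by simp
  hence "(deriv f has_field_derivative 32 * (2 * Q + 3) / (9 * Q ^ 5 * P ^ 3)) (at u)"
    by (rule has_field_derivative_transform_within_open[OF _ S u]) (simp add: f')
  hence f'': "deriv (deriv f) u = 32 * (2 * Q + 3) / (9 * Q ^ 5 * P ^ 3)"
    by (rule DERIV_imp_deriv)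
  have "1 - u = Q\<^sup>2 * (Q + 3) / 4"
    using eq[OF u] by (simp add: Q_def)
  \<comment> \<open>At \<open>u = 0\<close> the cubic has the simple root 1 and the double root -2.
    The resulting factor \<open>P^2\<close> reduces the \<open>P^3\<close> in the denominator of the
    second derivative to \<open>P\<close>.\<close>
  moreover from this have "u = - (Q - 1) * P\<^sup>2 / 4"
    by (simp add: P_def power2_eq_square field_simps)
  ultimately have "u * (1 - u) * deriv (deriv f) u =
      - (Q - 1) * P\<^sup>2 / 4 * (Q\<^sup>2 * (Q + 3) / 4) * (32 * (2 * Q + 3) / (9 * Q ^ 5 * P ^ 3))"
    unfolding f'' by metis
  also have "\<dots> = - 2 * (Q - 1) * (Q + 3) * (2 * Q + 3) / (9 * Q ^ 3 * P)"
    using Q P by (simp add: divide_simps power_numeral_reduce) (simp add: algebra_simps)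
  finally have t2: "u * (1 - u) * deriv (deriv f) u =
      - 2 * (Q - 1) * (Q + 3) * (2 * Q + 3) / (9 * Q ^ 3 * P)" .
  have "1 / 2 - 2 * u = 2 * (1 - u) - 3 / 2" by simp
  also have "\<dots> = (Q ^ 3 + 3 * Q\<^sup>2 - 3) / 2"
    unfolding \<open>1 - u = _\<close> by (simp add: power2_eq_square power3_eq_cube field_simps)
  finally have "1 / 2 - 2 * u = (Q ^ 3 + 3 * Q\<^sup>2 - 3) / 2" .
  hence "(1 / 2 - 2 * u) * deriv f u = (Q ^ 3 + 3 * Q\<^sup>2 - 3) / 2 * (4 / (3 * Q ^ 3 * P))"
    unfolding f'[OF u] Q_def[symmetric] P_def[symmetric] by metis
  also have "\<dots> = 6 * (Q ^ 3 + 3 * Q\<^sup>2 - 3) / (9 * Q ^ 3 * P)"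
    using Q P by (simp add: divide_simps)
  finally have t1: "(1 / 2 - 2 * u) * deriv f u =
      6 * (Q ^ 3 + 3 * Q\<^sup>2 - 3) / (9 * Q ^ 3 * P)" .
  have t0: "2 / 9 * f u = 2 * Q\<^sup>2 * P / (9 * Q ^ 3 * P)"
    using Q P unfolding f_def Q_def[symmetric] by (simp add: divide_simps power_numeral_reduce)
  \<comment> \<open>The numerators of the three terms over the common denominator
    \<open>9 * Q ^ 3 * P\<close> cancel.\<close>
  have "- 2 * (Q - 1) * (Q + 3) * (2 * Q + 3) + 6 * (Q ^ 3 + 3 * Q\<^sup>2 - 3) - 2 * Q\<^sup>2 * P = 0"
    by (simp add: P_def algebra_simps power_numeral_reduce)
  thus ?thesis
    unfolding t2 t1 t0 by (simp flip: add_divide_distrib diff_divide_distrib)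
qed

text \<open>With \<open>C\<close> the inverse of \<open>cheb3\<close> at
  \<open>csqrt (1 - u)\<close>, one has \<open>C * q = csqrt (1 - u)\<close>. Both \<open>C\<close>
  and this square root lie in the right half plane, which excludes the values 0 and -2 of
  \<open>q\<close>. The last clause says that this branch is the positive root for real
  \<open>u < 1\<close>.\<close>

lemma ex_cubic_root:
  obtains q where "q holomorphic_on slit_plane"
    "\<And>u. u \<in> slit_plane \<Longrightarrow> (q u)\<^sup>2 * (q u + 3) = 4 * (1 - u)"
    "\<And>u. u \<in> slit_plane \<Longrightarrow> q u \<noteq> 0" "\<And>u. u \<in> slit_plane \<Longrightarrow> q u \<noteq> -2"
    "\<And>r. r > 0 \<Longrightarrow> q (1 - of_real (r\<^sup>2 * (r + 3) / 4)) = of_real r"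
proof -
  have "cheb3 holomorphic_on cheb3_dom"
    unfolding cheb3_def by (intro holomorphic_intros)
  then obtain g where holg: "g holomorphic_on cheb3 ` cheb3_dom"
    and g: "\<And>w. w \<in> cheb3_dom \<Longrightarrow> g (cheb3 w) = w"
    using holomorphic_has_inverse[OF _ open_cheb3_dom inj_on_cheb3] by metis
  define C where "C = (\<lambda>u. g (csqrt (1 - u)))"
  define q where "q = (\<lambda>u. 4 * (C u)\<^sup>2 - 3)"
  have csqrt: "csqrt (1 - u) \<in> half_plane" if "u \<in> slit_plane" for u
  proof -
    have "1 - u \<notin> \<real>\<^sub>\<le>\<^sub>0" using that by (simp add: slit_plane_iff)
    \<comment> \<open>A purely imaginary square root would put \<open>1 - u\<close> on the
      nonpositive real axis, outside the slit plane condition.\<close>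
    moreover have "1 - u = of_real (- (Im (csqrt (1 - u)))\<^sup>2)" if "Re (csqrt (1 - u)) = 0"
    proof -
      have "1 - u = (csqrt (1 - u))\<^sup>2" by simp
      also have "\<dots> = of_real (- (Im (csqrt (1 - u)))\<^sup>2)"
        unfolding complex_eq_iff Re_power2 Im_power2 that by simp
      finally show ?thesis .
    qed
    ultimately have "Re (csqrt (1 - u)) \<noteq> 0"
      by (metis neg_le_0_iff_le nonpos_Reals_of_real_iff zero_le_power2)
    hence "Re (csqrt (1 - u)) > 0"
      using csqrt_principal[of "1 - u"] by linarith
    thus ?thesis by (simp add: half_plane_def)
  qed
  have C_dom: "C u \<in> cheb3_dom" and cheb3_C: "cheb3 (C u) = csqrt (1 - u)"
    if u: "u \<in> slit_plane" for u
  proof -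
    obtain w where w: "w \<in> cheb3_dom" "csqrt (1 - u) = cheb3 w"
      using csqrt[OF u] unfolding cheb3_image[symmetric] by (elim imageE)
    thus "C u \<in> cheb3_dom" "cheb3 (C u) = csqrt (1 - u)"
      using g[OF w(1)] by (auto simp: C_def)
  qed
  have Cq: "C u * q u = csqrt (1 - u)" if "u \<in> slit_plane" for u
    unfolding cheb3_C[OF that, symmetric]
    by (simp add: q_def cheb3_def power2_eq_square power3_eq_cube algebra_simps)
  show ?thesis
  proof (rule that[of q])
    have "(g \<circ> (\<lambda>u. csqrt (1 - u))) holomorphic_on slit_plane"
      by (rule holomorphic_on_compose_gen[OF _ holg])
         (use csqrt in \<open>auto simp: cheb3_image slit_plane_iff intro!: holomorphic_intros\<close>)
    thus "q holomorphic_on slit_plane"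
      unfolding q_def C_def o_def by (intro holomorphic_intros)
  next
    fix u assume u: "u \<in> slit_plane"
    \<comment> \<open>Here \<open>q u + 3 = 4 * (C u)^2\<close> by construction.\<close>
    have "(q u)\<^sup>2 * (q u + 3) = 4 * (C u * q u)\<^sup>2"
      by (simp add: q_def power2_eq_square algebra_simps)
    also have "\<dots> = 4 * (1 - u)" using Cq[OF u] by simp
    finally show "(q u)\<^sup>2 * (q u + 3) = 4 * (1 - u)" .
    show "q u \<noteq> 0"
      using Cq[OF u] csqrt[OF u] by (auto simp: half_plane_def)
    show "q u \<noteq> -2"
    proof
      assume "q u = -2"
      hence "csqrt (1 - u) = - 2 * C u" using Cq[OF u] by (simp add: mult.commute)
      hence "Re (csqrt (1 - u)) = - 2 * Re (C u)" by simp
      thus False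
        using csqrt[OF u] C_dom[OF u] by (simp add: half_plane_def cheb3_dom_def)
    qed
  next
    fix r :: real assume r: "r > 0"
    \<comment> \<open>The expected value of \<open>C\<close>: the positive solution of
      \<open>4 * w^2 - 3 = r\<close>. Then \<open>cheb3 w = w * r\<close> is positive, so
      \<open>w\<close> lies in \<open>cheb3_dom\<close>.\<close>
    define w where "w = sqrt (r + 3) / 2"
    have w: "w > 0" "4 * w\<^sup>2 = r + 3" using r by (auto simp: w_def power_divide)
    have cheb: "cheb3 (of_real w) = of_real (w * r)"
    proof -
      have "4 * w ^ 3 - 3 * w = w * (4 * w\<^sup>2 - 3)"
        by (simp add: power2_eq_square power3_eq_cube algebra_simps)
      hence "4 * w ^ 3 - 3 * w = w * r"
        using w(2) by simp
      thus ?thesis by (metis cheb3_def of_real_diff of_real_mult of_real_numeral of_real_power)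
    qed
    have "r\<^sup>2 * (r + 3) / 4 = (w * r)\<^sup>2"
      using w(2) by (simp add: power2_eq_square)
    hence "csqrt (1 - (1 - complex_of_real (r\<^sup>2 * (r + 3) / 4))) = of_real (w * r)"
      using w r by (simp add: of_real_sqrt[symmetric])
    also have "\<dots> = cheb3 (of_real w)" using cheb by simp
    finally have "C (1 - of_real (r\<^sup>2 * (r + 3) / 4)) = of_real w"
      using g[of "of_real w"] w r cheb by (simp add: C_def cheb3_dom_def)
    hence "q (1 - of_real (r\<^sup>2 * (r + 3) / 4)) = of_real (4 * w\<^sup>2 - 3)"
      by (simp add: q_def)
    thus "q (1 - of_real (r\<^sup>2 * (r + 3) / 4)) = of_real r"
      using w(2) by simp
  qed
qed

text \<open>Parametrising the argument by the root \<open>r\<close> avoids solving the cubic. For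
  \<open>r = 3 z\<close> the subtracted term is 27/2 times \<open>(z^3 + z^2) / 2\<close>.\<close>

lemma hyp2F1_third_two_thirds_half:
  assumes r: "r > 0"
  shows "hyp2F1 (1/3) (2/3) (1/2) (1 - of_real (r\<^sup>2 * (r + 3) / 4)) = 1 / of_real r"
proof -
  obtain q where holq: "q holomorphic_on slit_plane"
    and eq: "\<And>u. u \<in> slit_plane \<Longrightarrow> (q u)\<^sup>2 * (q u + 3) = 4 * (1 - u)"
    and nz: "\<And>u. u \<in> slit_plane \<Longrightarrow> q u \<noteq> 0" "\<And>u. u \<in> slit_plane \<Longrightarrow> q u \<noteq> -2"
    and val: "\<And>r. r > 0 \<Longrightarrow> q (1 - of_real (r\<^sup>2 * (r + 3) / 4)) = of_real r"
    using ex_cubic_root by blast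
  have "hyp2F1 (1/3) (2/3) (1/2) (1 - of_real (r\<^sup>2 * (r + 3) / 4)) =
      (\<lambda>u. 1 / q u) (1 - of_real (r\<^sup>2 * (r + 3) / 4))"
  proof (rule hyp2F1_eqI_ode)
    show "(\<lambda>u. 1 / q u) holomorphic_on slit_plane"
      by (intro holomorphic_intros holq nz)
    \<comment> \<open>The parameter \<open>r = 1\<close> corresponds to the argument 0.\<close>
    show "1 / q 0 = 1" using val[of 1] by simp
    show "(1 / 2 :: complex) \<noteq> - of_nat n" for n
    proof
      assume "(1 / 2 :: complex) = - of_nat n"
      hence "Re (1 / 2) = Re (- of_nat n)" by (rule arg_cong)
      thus False by simp
    qed
    show "1 - complex_of_real (r\<^sup>2 * (r + 3) / 4) \<in> slit_plane"
    proof -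
      have "r\<^sup>2 * (r + 3) / 4 > 0" using r by simp
      moreover have "1 - (1 - complex_of_real (r\<^sup>2 * (r + 3) / 4)) = of_real (r\<^sup>2 * (r + 3) / 4)"
        by (simp only: diff_diff_eq2 add_diff_cancel_left')
      ultimately show ?thesis
        unfolding slit_plane_iff by (simp only: nonpos_Reals_of_real_iff not_le)
    qed
    show "u * (1 - u) * deriv (deriv (\<lambda>u. 1 / q u)) u +
        (1/2 - (1/3 + 2/3 + 1) * u) * deriv (\<lambda>u. 1 / q u) u - 1/3 * (2/3) * (1 / q u) = 0"
      if "u \<in> slit_plane" for u
      using hypergeometric_ode_inverse_cubic_root[OF holq open_slit_plane eq nz that] by simp
  qed
  thus ?thesis using val[OF r] by simp
qed

section \<open>The real inverse function \<open>MY\<close>\<close>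

lemma MY_pos_and_cubic:
  assumes x: "x > 0"
  shows "MY x > 0" "((MY x) ^ 3 + (MY x) ^ 2) / 2 = x"
proof -
  let ?p = "\<lambda>z::real. (z ^ 3 + z ^ 2) / 2"
  have inj: "inj_on ?p {0..}"
  proof (rule strict_mono_on_imp_inj_on, rule strict_mono_onI)
    fix y z :: real assume "y \<in> {0..}" "y < z"
    thus "?p y < ?p z"
      using power_strict_mono[of y z 3] power_strict_mono[of y z 2] by simp
  qed
  \<comment> \<open>The bound \<open>1 + 2 * x\<close> is at least 1, so its square is at least
    itself and \<open>?p\<close> there is at least \<open>(1 + 2 * x) / 2\<close>, which exceeds
    \<open>x\<close>.\<close>
  have "\<exists>z\<ge>0. z \<le> 1 + 2 * x \<and> ?p z = x"
  proof (rule IVT')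
    have "(1 + 2 * x) ^ 2 \<ge> 1 + 2 * x" "(1 + 2 * x) ^ 3 \<ge> 0"
      using x by (auto simp: power2_eq_square)
    thus "x \<le> ?p (1 + 2 * x)" using x by argo
  qed (use x in \<open>auto intro!: continuous_intros\<close>)
  then obtain z where z: "z \<in> {0..}" "?p z = x" by auto
  have "x \<in> ?p ` {0..}" using imageI[OF z(1), of ?p] unfolding z(2) .
  hence "MY x \<in> {0..}" and *: "?p (MY x) = x"
    unfolding MY_def using the_inv_into_into[OF inj] f_the_inv_into_f[OF inj] by auto
  moreover have "MY x \<noteq> 0" using * x by auto
  ultimately show "MY x > 0" "?p (MY x) = x" by auto
qed

theorem mainTheorem4:
  fixes x :: real
  assumes "x > 0"
  shows "complex_of_real (MY x) =
           1 / (3 * hyp2F1 (1/3) (2/3) (1/2) (1 - 27 * complex_of_real x / 2))"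
proof -
  define r where "r = 3 * MY x"
  have r: "r > 0" using MY_pos_and_cubic[OF assms] by (simp add: r_def)
  have "r\<^sup>2 * (r + 3) / 4 = 27 * (((MY x) ^ 3 + (MY x) ^ 2) / 2) / 2"
    by (simp add: r_def power2_eq_square power3_eq_cube algebra_simps)
  hence eq: "r\<^sup>2 * (r + 3) / 4 = 27 * x / 2"
    unfolding MY_pos_and_cubic(2)[OF assms] .
  have "hyp2F1 (1/3) (2/3) (1/2) (1 - 27 * complex_of_real x / 2) = 1 / of_real r"
    using hyp2F1_third_two_thirds_half[OF r] unfolding eq by simp
  thus ?thesis by (simp add: r_def)
qed

end
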